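(* Let $E$ be a nonzero real Banach space and let $A \subset E \times E^*$ be quasidense in $E \times E^*$. Then, for all $(y^*, y^{**}) \in E^* \times E^{**}$, $$\inf_{(s,s^* ) \in A}\langle s^* - y^*, \widehat{s} - y^{**}\rangle \le 0.$$
   Context: $E^*$ and $E^{**}$ are the dual and bidual of $E$, with pairings $\langle x, x^*\rangle$ ($x \in E$, $x^* \in E^*$) and $\langle x^*, x^{**}\rangle$ ($x^* \in E^*$, $x^{**} \in E^{**}$); $\widehat{s}$ denotes the canonical image of $s \in E$ in $E^{**}$. A subset $A \subset E \times E^*$ is quasidense (in $E \times E^*$) if, for all $(x,x^* ) \in E \times E^*$, $\inf_{(s,s^* ) \in A}\big[\frac12\|s-x\|^2 + \frac12\|s^*-x^*\|^2 + \langle s-x, s^*-x^*\rangle\big] \le 0$ (equivalently $=0$, the bracket being always $\ge 0$). No monotonicity of $A$ is assumed. *)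

theory Defs
  imports "HOL-Analysis.Analysis"
begin

type_synonym 'a dual = "'a \<Rightarrow>\<^sub>L real"

type_synonym 'a bidual = "'a dual dual"

lift_definition canonical_image :: "'a::real_normed_vector \<Rightarrow> 'a bidual"
  is "\<lambda>x x'. blinfun_apply x' x"
  by (rule blinfun.bounded_linear_left)

text \<open>Infima are taken in the extended reals: the infimum over the empty set is \<open>\<infinity>\<close>,
  and the infimum of a set that is unbounded below is \<open>-\<infinity>\<close>.\<close>

definition quasidense :: "('a::real_normed_vector \<times> 'a dual) set \<Rightarrow> bool" where
  "quasidense A \<longleftrightarrow>
    (\<forall>x x'. (INF (s, s') \<in> A.
       ereal (1/2 * (norm (s - x))\<^sup>2 + 1/2 * (norm (s' - x'))\<^sup>2
              + blinfun_apply (s' - x') (s - x))) \<le> 0)"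

end

theory Submission
  imports Defs
begin

text \<open>Fix \<open>y'\<close> and \<open>y''\<close>. Quasidensity is only applied at points \<open>(0, y' + w)\<close>, where \<open>w\<close> is
  a dual vector that nearly aligns with \<open>y''\<close>, in the sense that
  \<open>1/2 * \<parallel>w\<parallel>\<^sup>2 + 1/2 * \<parallel>y''\<parallel>\<^sup>2 - y'' w\<close> is small. For \<open>(s, s')\<close> in \<open>A\<close>, put \<open>t = s' - y'\<close>.
  Young's inequality, for the pairings of \<open>w\<close> with \<open>s\<close> and of \<open>t - w\<close> with \<open>y''\<close>, bounds
  \<open>t s - y'' t\<close> by
  \<open>(1/2 * \<parallel>s\<parallel>\<^sup>2 + 1/2 * \<parallel>t - w\<parallel>\<^sup>2 + (t - w) s) + (1/2 * \<parallel>w\<parallel>\<^sup>2 + 1/2 * \<parallel>y''\<parallel>\<^sup>2 - y'' w)\<close>.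
  The first bracket is the quasidensity bracket of \<open>A\<close> at \<open>(0, y' + w)\<close>, so a suitable
  \<open>(s, s')\<close> makes it as small as desired, and the second one is small by the choice of \<open>w\<close>.
  Such a \<open>w\<close> exists by \<open>exists_nearly_aligned_vector\<close>: the functional \<open>y''\<close> is nearly
  normed by a vector of the dual, on which it acts.\<close>

lemma INF_ereal_le_0_iff:
  "(INF p \<in> A. ereal (f p)) \<le> 0 \<longleftrightarrow> (\<forall>e>0. \<exists>p\<in>A. f p < e)"
proof
  assume le: "(INF p \<in> A. ereal (f p)) \<le> 0"
  show "\<forall>e>0. \<exists>p\<in>A. f p < e"
  proof (intro allI impI)
    fix e :: real assume "e > 0"
    then have "(INF p \<in> A. ereal (f p)) < ereal e"
      using le by (simp add: le_less_trans)
    then show "\<exists>p\<in>A. f p < e" by (simp add: INF_less_iff)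
  qed
next
  assume small: "\<forall>e>0. \<exists>p\<in>A. f p < e"
  show "(INF p \<in> A. ereal (f p)) \<le> 0"
  proof -
    have "(INF p \<in> A. ereal (f p)) \<le> 0 + ereal e" if e: "e > 0" for e :: real
    proof -
      obtain p where "p \<in> A" "f p < e" using small e by blast
      then show ?thesis by (intro INF_lower2[of p]) auto
    qed
    then show ?thesis using ereal_le_epsilon2 by blast
  qed
qed

lemma abs_blinfun_apply_le_half_squares:
  fixes f :: "'b::real_normed_vector \<Rightarrow>\<^sub>L real"
  shows "\<bar>blinfun_apply f v\<bar> \<le> 1/2 * (norm f)\<^sup>2 + 1/2 * (norm v)\<^sup>2"
proof -
  have "\<bar>blinfun_apply f v\<bar> \<le> norm f * norm v"
    using norm_blinfun[of f v] by simp
  also have "\<dots> \<le> 1/2 * (norm f)\<^sup>2 + 1/2 * (norm v)\<^sup>2"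
    using sum_squares_bound[of "norm f" "norm v"] by simp
  finally show ?thesis .
qed

text \<open>The norm of \<open>f\<close> is a supremum that need not be attained, but rescaling a vector that nearly
  attains it to norm \<open>\<parallel>f\<parallel>\<close> makes Young's inequality an equality up to \<open>e\<close>.\<close>

lemma exists_nearly_aligned_vector:
  fixes f :: "'b::real_normed_vector \<Rightarrow>\<^sub>L real"
  assumes "e > 0"
  shows "\<exists>w. 1/2 * (norm w)\<^sup>2 + 1/2 * (norm f)\<^sup>2 - blinfun_apply f w < e"
proof (cases "f = 0")
  case True
  then show ?thesis using assms by (intro exI[of _ 0]) simp
next
  case False
  define M where "M = norm f"
  have M: "M > 0" using False by (simp add: M_def)
  \<comment> \<open>The deficit \<open>e / M\<close> in the operator norm becomes \<open>e\<close> once the vector has norm \<open>M\<close>; the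
    maximum with 0 covers the case of a large \<open>e\<close>.\<close>
  define b where "b = max 0 (M - e / M)"
  have "b < M" using M assms by (simp add: b_def)
  have "\<exists>v. \<not> norm (blinfun_apply f v) \<le> b * norm v"
  proof (rule ccontr)
    assume "\<not> ?thesis"
    then have "norm f \<le> b" by (intro norm_blinfun_bound) (auto simp: b_def)
    then show False using \<open>b < M\<close> by (simp add: M_def)
  qed
  then obtain v where v: "b * norm v < \<bar>blinfun_apply f v\<bar>" by (auto simp: not_le)
  have "v \<noteq> 0" using v by auto
  then have nv: "norm v > 0" by simp
  have fv: "blinfun_apply f v \<noteq> 0"
  proof
    assume "blinfun_apply f v = 0"
    then have "b * norm v < 0" using v by simp
    then show False by (simp add: b_def mult_less_0_iff)
  qed
  define w where "w = (M / norm v * sgn (blinfun_apply f v)) *\<^sub>R v"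
  have nw: "norm w = M"
    using M nv fv by (simp add: w_def abs_mult abs_sgn_eq)
  have fw: "blinfun_apply f w = M * (\<bar>blinfun_apply f v\<bar> / norm v)"
    by (simp add: w_def blinfun.scaleR_right abs_sgn mult_ac)
  have "M - e / M \<le> b" by (simp add: b_def)
  also have "b < \<bar>blinfun_apply f v\<bar> / norm v" using v nv by (simp add: less_divide_eq)
  finally have "M * (M - e / M) < blinfun_apply f w"
    unfolding fw by (rule mult_strict_left_mono[OF _ M])
  then have "M\<^sup>2 - e < blinfun_apply f w"
    using M by (simp add: algebra_simps power2_eq_square)
  then have "1/2 * (norm w)\<^sup>2 + 1/2 * (norm f)\<^sup>2 - blinfun_apply f w < e"
    by (simp add: nw flip: M_def)
  then show ?thesis ..
qed

theorem theorem3p5: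
  fixes A :: "('a::banach \<times> 'a dual) set"
  assumes "\<exists>x::'a. x \<noteq> 0"
    and "quasidense A"
  shows "\<forall>(y' :: 'a dual) (y'' :: 'a bidual).
    (INF (s, s') \<in> A. ereal (blinfun_apply (canonical_image s - y'') (s' - y'))) \<le> 0"
proof (intro allI)
  fix y' :: "'a dual" and y'' :: "'a bidual"
  have "\<exists>p\<in>A. blinfun_apply (canonical_image (fst p) - y'') (snd p - y') < e"
    if e: "e > 0" for e :: real
  proof -
    have "e / 2 > 0" using e by simp
    obtain w where w: "1/2 * (norm w)\<^sup>2 + 1/2 * (norm y'')\<^sup>2 - blinfun_apply y'' w < e / 2"
      using exists_nearly_aligned_vector[of "e / 2" y''] e by auto
    have "(INF p \<in> A. ereal (1/2 * (norm (fst p - 0))\<^sup>2 + 1/2 * (norm (snd p - (y' + w)))\<^sup>2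
              + blinfun_apply (snd p - (y' + w)) (fst p - 0))) \<le> 0"
      using assms(2) unfolding quasidense_def case_prod_unfold by blast
    then obtain p where p: "p \<in> A"
      "1/2 * (norm (fst p - 0))\<^sup>2 + 1/2 * (norm (snd p - (y' + w)))\<^sup>2
              + blinfun_apply (snd p - (y' + w)) (fst p - 0) < e / 2"
      unfolding INF_ereal_le_0_iff using \<open>e / 2 > 0\<close> by blast
    define s where "s = fst p"
    define t where "t = snd p - y'"
    have q: "1/2 * (norm s)\<^sup>2 + 1/2 * (norm (t - w))\<^sup>2 + blinfun_apply t s - blinfun_apply w s < e / 2"
      using p(2) by (simp add: s_def t_def blinfun.diff_left blinfun.add_left algebra_simps)
    have ws: "blinfun_apply w s \<le> 1/2 * (norm w)\<^sup>2 + 1/2 * (norm s)\<^sup>2"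
      using abs_blinfun_apply_le_half_squares[of w s] by simp
    have yt: "blinfun_apply y'' w - blinfun_apply y'' t
        \<le> 1/2 * (norm y'')\<^sup>2 + 1/2 * (norm (t - w))\<^sup>2"
      using abs_blinfun_apply_le_half_squares[of y'' "t - w"] by (simp add: blinfun.diff_right)
    have "blinfun_apply (canonical_image s - y'') t = blinfun_apply t s - blinfun_apply y'' t"
      by (simp add: blinfun.diff_left canonical_image.rep_eq)
    also have "\<dots> < e" using q ws yt w by linarith
    finally show ?thesis using p(1) by (auto simp: s_def t_def)
  qed
  then show "(INF (s, s') \<in> A. ereal (blinfun_apply (canonical_image s - y'') (s' - y'))) \<le> 0"
    unfolding case_prod_unfold INF_ereal_le_0_iff by blast
qed

end
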